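(* Let $(X,d)$ be a CAT(0) space and let $T_1, T_2 : X \to X$ be mappings satisfying property $(P_2)$. Let $\lambda \in (0,1)$ and let $T : X \to X$ be defined by $Tx := (1-\lambda)T_1x + \lambda T_2x$ for all $x \in X$. Assume that $Fix(T) \neq \emptyset$. Then $T$ is asymptotically regular, i.e. for every $x \in X$, $\lim_{n\to\infty} d(T^nx, T^{n+1}x) = 0$.
   Context: A geodesic joining $x,y$ in a metric space $(X,d)$ is a map $\gamma:[0,1]\to X$ with $\gamma(0)=x$, $\gamma(1)=y$ and $d(\gamma(t),\gamma(t'))=|t-t'|\,d(x,y)$ for all $t,t'\in[0,1]$; $(X,d)$ is geodesic if any two points are joined by a geodesic. A CAT(0) space is a geodesic space such that for every geodesic $\gamma:[0,1]\to X$, every $z\in X$ and $t\in[0,1]$, $d^2(z,\gamma(t))\le (1-t)d^2(z,\gamma(0))+t\,d^2(z,\gamma(1))-t(1-t)d^2(\gamma(0),\gamma(1))$ (completeness is not assumed). Geodesics in a CAT(0) space are unique, and $(1-t)x+ty$ denotes the point $\gamma(t)$ on the unique geodesic $\gamma$ joining $x$ to $y$. A mapping $T:X\to X$ satisfies property $(P_2)$ if for all $x,y\in X$, $2d^2(Tx,Ty)\le d^2(x,Ty)+d^2(y,Tx)-d^2(x,Tx)-d^2(y,Ty)$. $Fix(T)$ denotes the set of fixed points of $T$. *)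

theory Defs
  imports "HOL-Analysis.Analysis"
begin

text \<open>
  Metric spaces are carrier-based (locale \<^locale>\<open>Metric_space\<close>), and self-maps of a space
  with carrier \<open>M\<close> are functions in \<open>M \<rightarrow> M\<close>. Only the values of a path on \<open>{0..1}\<close> matter.
\<close>

context Metric_space
begin

definition geodesic :: "(real \<Rightarrow> 'a) \<Rightarrow> 'a \<Rightarrow> 'a \<Rightarrow> bool" where
  "geodesic \<gamma> x y \<longleftrightarrow> \<gamma> \<in> {0..1} \<rightarrow> M \<and> \<gamma> 0 = x \<and> \<gamma> 1 = y \<and>
     (\<forall>t\<in>{0..1}. \<forall>t'\<in>{0..1}. d (\<gamma> t) (\<gamma> t') = \<bar>t - t'\<bar> * d x y)"

definition property_P2 :: "('a \<Rightarrow> 'a) \<Rightarrow> bool" where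
  "property_P2 T \<longleftrightarrow> (\<forall>x\<in>M. \<forall>y\<in>M.
     2 * (d (T x) (T y))\<^sup>2 \<le> (d x (T y))\<^sup>2 + (d y (T x))\<^sup>2 - (d x (T x))\<^sup>2 - (d y (T y))\<^sup>2)"

definition Fix :: "('a \<Rightarrow> 'a) \<Rightarrow> 'a set" where
  "Fix T = {x \<in> M. T x = x}"

definition asymptotically_regular :: "('a \<Rightarrow> 'a) \<Rightarrow> bool" where
  "asymptotically_regular T \<longleftrightarrow>
     (\<forall>x\<in>M. (\<lambda>n. d ((T ^^ n) x) ((T ^^ (n + 1)) x)) \<longlonglongrightarrow> 0)"

end

locale geodesic_space = Metric_space +
  assumes ex_geodesic: "\<lbrakk>x \<in> M; y \<in> M\<rbrakk> \<Longrightarrow> \<exists>\<gamma>. geodesic \<gamma> x y"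

locale CAT0_space = geodesic_space +
  assumes CAT0: "\<lbrakk>geodesic \<gamma> x y; z \<in> M; t \<in> {0..1}\<rbrakk> \<Longrightarrow>
    (d z (\<gamma> t))\<^sup>2 \<le> (1 - t) * (d z (\<gamma> 0))\<^sup>2 + t * (d z (\<gamma> 1))\<^sup>2 - t * (1 - t) * (d (\<gamma> 0) (\<gamma> 1))\<^sup>2"
begin

lemma geodesic_unique:
  assumes g: "geodesic \<gamma> x y" and h: "geodesic \<delta> x y" and t: "t \<in> {0..1}"
  shows "\<gamma> t = \<delta> t"
proof -
  have ends: "\<gamma> 0 = x" "\<gamma> 1 = y" "\<delta> 0 = x" "\<delta> 1 = y"
    and M: "\<gamma> t \<in> M" "\<delta> t \<in> M"
    using g h t unfolding geodesic_def Pi_iff by (blast+)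
  have dist: "\<forall>s\<in>{0..1}. \<forall>s'\<in>{0..1}. d (\<delta> s) (\<delta> s') = \<bar>s - s'\<bar> * d x y"
    using h unfolding geodesic_def by blast
  have "d (\<delta> t) x = t * d x y" "d (\<delta> t) y = (1 - t) * d x y"
    using dist[rule_format, of t 0] dist[rule_format, of t 1] t unfolding ends by simp_all
  moreover have "(d (\<delta> t) (\<gamma> t))\<^sup>2 \<le>
      (1 - t) * (d (\<delta> t) x)\<^sup>2 + t * (d (\<delta> t) y)\<^sup>2 - t * (1 - t) * (d x y)\<^sup>2"
    using CAT0[OF g M(2) t] unfolding ends .
  ultimately have "(d (\<delta> t) (\<gamma> t))\<^sup>2 \<le>
      (1 - t) * (t * d x y)\<^sup>2 + t * ((1 - t) * d x y)\<^sup>2 - t * (1 - t) * (d x y)\<^sup>2"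
    by (simp only:)
  also have "\<dots> = 0"
    by (simp add: power2_eq_square algebra_simps)
  finally have "d (\<delta> t) (\<gamma> t) = 0" by simp
  then show ?thesis using zero[OF M(2) M(1)] by (metis)
qed

text \<open>\<open>geod_comb t x y\<close> is the point \<open>(1 - t)x + ty\<close>, meaningful for \<open>x, y \<in> M\<close> and \<open>t \<in> {0..1}\<close>.\<close>

definition geod_comb :: "real \<Rightarrow> 'a \<Rightarrow> 'a \<Rightarrow> 'a" where
  "geod_comb t x y = (THE p. \<exists>\<gamma>. geodesic \<gamma> x y \<and> p = \<gamma> t)"

lemma geod_comb_eq:
  assumes "geodesic \<gamma> x y" "t \<in> {0..1}"
  shows "geod_comb t x y = \<gamma> t"
  unfolding geod_comb_def
proof (rule the_equality)
  show "\<exists>\<delta>. geodesic \<delta> x y \<and> \<gamma> t = \<delta> t"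
    using assms(1) by (intro exI[of _ \<gamma>] conjI refl)
next
  fix p
  assume "\<exists>\<delta>. geodesic \<delta> x y \<and> p = \<delta> t"
  then obtain \<delta> where \<delta>: "geodesic \<delta> x y" and p: "p = \<delta> t" by (elim exE conjE)
  show "p = \<gamma> t"
    unfolding p by (rule geodesic_unique[OF \<delta> assms])
qed

end

end

theory Submission
  imports Defs
begin

text \<open>
  Fix a fixed point \<open>p\<close> of \<open>T\<close>, so that \<open>p\<close> divides the geodesic from \<open>T1 p\<close> to \<open>T2 p\<close>, of
  length \<open>D\<close> say, in the ratio \<open>l : 1 - l\<close>. A point \<open>x\<close> is fixed by \<open>T\<close> as soon as the triangle
  \<open>x, T1 x, T2 x\<close> has the same side lengths as the degenerate triangle \<open>p, T1 p, T2 p\<close>, and the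
  proof shows that this happens asymptotically along every orbit.

  The comparison of the two triangles rests on the Cauchy--Schwarz inequality for the four points
  of a quadrilateral (\<open>quadrilateral_Cauchy_Schwarz\<close>). Combined with property \<open>(P\<^sub>2)\<close> it
  bounds the discrepancy between \<open>d x (Ti x)\<close> and \<open>d p (Ti p)\<close> by the amount by which \<open>Ti\<close>
  contracts the pair \<open>x, p\<close> (\<open>property_P2_defect\<close>); combined with the CAT(0) inequality it bounds
  the discrepancy between \<open>d (T1 x) (T2 x)\<close> and \<open>D\<close> by the amount by which taking convex
  combinations contracts (\<open>geod_comb_convex_defect\<close>). Adding up, the squares of all three
  discrepancies are controlled by \<open>(d x p)\<^sup>2 - (d (T x) p)\<^sup>2\<close> (\<open>triangle_defect_le\<close>). Along an
  orbit this difference tends to \<open>0\<close>, because \<open>d (T\<^sup>n x) p\<close> is decreasing in \<open>n\<close>. Hence the side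
  lengths converge to \<open>l D\<close>, \<open>(1 - l) D\<close> and \<open>D\<close>, and the CAT(0) inequality bounds the square of
  the distance from \<open>x\<close> to \<open>T x\<close> by an expression in the sides that vanishes in the limit.
\<close>

section \<open>Convex combinations and quadrilaterals in CAT(0) spaces\<close>

context CAT0_space
begin

lemma geod_comb_geodesic:
  assumes "x \<in> M" "y \<in> M" "t \<in> {0..1}"
  obtains \<gamma> where "geodesic \<gamma> x y" "geod_comb t x y = \<gamma> t"
proof -
  obtain \<gamma> where \<gamma>: "geodesic \<gamma> x y"
    using ex_geodesic[OF assms(1,2)] by (elim exE)
  show thesis
    by (rule that[OF \<gamma> geod_comb_eq[OF \<gamma> assms(3)]])
qed

lemma geodesicD:
  assumes "geodesic \<gamma> x y"
  shows "t \<in> {0..1} \<Longrightarrow> \<gamma> t \<in> M" and "\<gamma> 0 = x" and "\<gamma> 1 = y"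
    and "\<lbrakk>t \<in> {0..1}; t' \<in> {0..1}\<rbrakk> \<Longrightarrow> d (\<gamma> t) (\<gamma> t') = \<bar>t - t'\<bar> * d x y"
  using assms unfolding geodesic_def Pi_iff by (blast+)

lemma
  assumes "x \<in> M" "y \<in> M" "t \<in> {0..1}"
  shows geod_comb_in: "geod_comb t x y \<in> M"
    and dist_geod_comb_left: "d (geod_comb t x y) x = t * d x y"
    and dist_geod_comb_right: "d (geod_comb t x y) y = (1 - t) * d x y"
proof -
  obtain \<gamma> where \<gamma>: "geodesic \<gamma> x y" and comb: "geod_comb t x y = \<gamma> t"
    by (rule geod_comb_geodesic[OF assms])
  show "geod_comb t x y \<in> M"
    unfolding comb by (rule geodesicD(1)[OF \<gamma> assms(3)])
  show "d (geod_comb t x y) x = t * d x y"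
    using geodesicD(4)[OF \<gamma> assms(3), of 0] assms(3) by (simp add: comb geodesicD(2)[OF \<gamma>])
  show "d (geod_comb t x y) y = (1 - t) * d x y"
    using geodesicD(4)[OF \<gamma> assms(3), of 1] assms(3) by (simp add: comb geodesicD(3)[OF \<gamma>])
qed

lemma CAT0_geod_comb:
  assumes "x \<in> M" "y \<in> M" "z \<in> M" "t \<in> {0..1}"
  shows "(d z (geod_comb t x y))\<^sup>2 \<le> (1 - t) * (d z x)\<^sup>2 + t * (d z y)\<^sup>2 - t * (1 - t) * (d x y)\<^sup>2"
proof -
  obtain \<gamma> where \<gamma>: "geodesic \<gamma> x y" and comb: "geod_comb t x y = \<gamma> t"
    by (rule geod_comb_geodesic[OF assms(1,2,4)])
  show ?thesis
    using CAT0[OF \<gamma> assms(3,4)] unfolding comb geodesicD(2)[OF \<gamma>] geodesicD(3)[OF \<gamma>] .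
qed

text \<open>
  The CAT(0) inequality along the geodesic from \<open>u\<close> to \<open>v\<close>, with the distances to \<open>u\<close> and \<open>v\<close> estimated
  by the CAT(0) inequality along the geodesic from \<open>x\<close> to \<open>y\<close>.
\<close>

lemma dist_geod_comb_geod_comb_le:
  assumes "x \<in> M" "y \<in> M" "u \<in> M" "v \<in> M" "s \<in> {0..1}" "t \<in> {0..1}"
  shows "(d (geod_comb s x y) (geod_comb t u v))\<^sup>2
    \<le> (1 - s) * (1 - t) * (d x u)\<^sup>2 + (1 - s) * t * (d x v)\<^sup>2
      + s * (1 - t) * (d y u)\<^sup>2 + s * t * (d y v)\<^sup>2
      - s * (1 - s) * (d x y)\<^sup>2 - t * (1 - t) * (d u v)\<^sup>2"
proof -
  let ?m = "geod_comb s x y"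
  have m: "?m \<in> M"
    using assms by (simp add: geod_comb_in)
  have "(d ?m u)\<^sup>2 \<le> (1 - s) * (d x u)\<^sup>2 + s * (d y u)\<^sup>2 - s * (1 - s) * (d x y)\<^sup>2"
    using CAT0_geod_comb[OF assms(1,2,3,5)] by (simp add: commute)
  then have u: "(1 - t) * (d ?m u)\<^sup>2
      \<le> (1 - t) * ((1 - s) * (d x u)\<^sup>2 + s * (d y u)\<^sup>2 - s * (1 - s) * (d x y)\<^sup>2)"
    using assms(6) by (intro mult_left_mono) auto
  have "(d ?m v)\<^sup>2 \<le> (1 - s) * (d x v)\<^sup>2 + s * (d y v)\<^sup>2 - s * (1 - s) * (d x y)\<^sup>2"
    using CAT0_geod_comb[OF assms(1,2,4,5)] by (simp add: commute)
  then have v: "t * (d ?m v)\<^sup>2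
      \<le> t * ((1 - s) * (d x v)\<^sup>2 + s * (d y v)\<^sup>2 - s * (1 - s) * (d x y)\<^sup>2)"
    using assms(6) by (intro mult_left_mono) auto
  have "(d ?m (geod_comb t u v))\<^sup>2
      \<le> (1 - t) * (d ?m u)\<^sup>2 + t * (d ?m v)\<^sup>2 - t * (1 - t) * (d u v)\<^sup>2"
    by (rule CAT0_geod_comb[OF assms(3,4) m assms(6)])
  also have "\<dots> \<le> (1 - t) * ((1 - s) * (d x u)\<^sup>2 + s * (d y u)\<^sup>2 - s * (1 - s) * (d x y)\<^sup>2)
      + t * ((1 - s) * (d x v)\<^sup>2 + s * (d y v)\<^sup>2 - s * (1 - s) * (d x y)\<^sup>2)
      - t * (1 - t) * (d u v)\<^sup>2"
    using u v by linarith
  finally show ?thesis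
    by (simp add: algebra_simps)
qed

text \<open>
  With the quasi-inner product \<open>2\<langle>ac, be\<rangle> = (d a e)\<^sup>2 + (d c b)\<^sup>2 - (d a b)\<^sup>2 - (d c e)\<^sup>2\<close> of
  Berg and Nikolaev, this is the Cauchy--Schwarz inequality \<open>\<langle>ac, be\<rangle> \<le> d a c * d b e\<close>.
  Take the point at parameter \<open>t\<close> on the diagonal from \<open>a\<close> to \<open>e\<close> and the one at parameter
  \<open>1 - t\<close> on the diagonal from \<open>b\<close> to \<open>c\<close>. The squared distance of these points is nonnegative,
  which yields, after division by \<open>t(1 - t)\<close>, the weighted estimate
  \<open>2\<langle>ac, be\<rangle> \<le> ((1 - t)/t) (d a c)\<^sup>2 + (t/(1 - t)) (d b e)\<^sup>2\<close>, and \<open>t\<close> can be optimised.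
\<close>

lemma quadrilateral_Cauchy_Schwarz:
  assumes "a \<in> M" "b \<in> M" "c \<in> M" "e \<in> M"
  shows "(d a e)\<^sup>2 + (d b c)\<^sup>2 \<le> (d a b)\<^sup>2 + (d c e)\<^sup>2 + 2 * d a c * d b e"
proof (cases "d a c = 0 \<or> d b e = 0")
  case True
  then have "a = c \<or> b = e"
    using zero assms by blast
  then show ?thesis
    using True by (auto simp: commute)
next
  case False
  define P Q where "P = d a c" and "Q = d b e"
  have PQ: "P > 0" "Q > 0"
    using False nonneg[of a c] nonneg[of b e] unfolding P_def Q_def by linarith+
  \<comment> \<open>the parameter for which both terms of the weighted estimate become \<open>d a c * d b e\<close>\<close>
  define t where "t = P / (P + Q)"
  have t: "t \<in> {0..1}" "1 - t \<in> {0..1}"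
    and Pt: "t * (P + Q) = P" and Qt: "(1 - t) * (P + Q) = Q"
    using PQ by (auto simp: t_def field_simps)
  have "0 \<le> (d (geod_comb t a e) (geod_comb (1 - t) b c))\<^sup>2"
    by simp
  also have "\<dots> \<le> (1 - t) * t * ((d a b)\<^sup>2 + (d c e)\<^sup>2 - (d a e)\<^sup>2 - (d b c)\<^sup>2)
      + ((1 - t) * P)\<^sup>2 + (t * Q)\<^sup>2"
    using dist_geod_comb_geod_comb_le[OF assms(1,4,2,3) t]
    by (simp add: P_def Q_def commute algebra_simps power2_eq_square)
  finally have "0 \<le> (P + Q)\<^sup>2 * ((1 - t) * t * ((d a b)\<^sup>2 + (d c e)\<^sup>2 - (d a e)\<^sup>2 - (d b c)\<^sup>2)
      + ((1 - t) * P)\<^sup>2 + (t * Q)\<^sup>2)"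
    by simp
  also have "\<dots> = ((1 - t) * (P + Q)) * (t * (P + Q)) * ((d a b)\<^sup>2 + (d c e)\<^sup>2 - (d a e)\<^sup>2 - (d b c)\<^sup>2)
      + ((1 - t) * (P + Q) * P)\<^sup>2 + (t * (P + Q) * Q)\<^sup>2"
    by (simp add: algebra_simps power2_eq_square)
  also have "\<dots> = (P * Q) * ((d a b)\<^sup>2 + (d c e)\<^sup>2 + 2 * P * Q - (d a e)\<^sup>2 - (d b c)\<^sup>2)"
    unfolding Pt Qt by (simp add: algebra_simps power2_eq_square)
  finally have "0 \<le> (d a b)\<^sup>2 + (d c e)\<^sup>2 + 2 * P * Q - (d a e)\<^sup>2 - (d b c)\<^sup>2"
    using mult_pos_pos[OF PQ] by (simp only: zero_le_mult_iff) linarith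
  then show ?thesis
    by (simp add: P_def Q_def)
qed

text \<open>
  The last term quantifies the loss in the convexity of the metric: for \<open>0 < t < 1\<close>, near-equality
  forces the two geodesics to have almost the same length. It appears because the diagonals \<open>d x v\<close> and
  \<open>d y u\<close> in the estimate for two convex combinations are bounded by the Cauchy--Schwarz
  inequality.
\<close>

lemma geod_comb_convex_defect:
  assumes "x \<in> M" "y \<in> M" "u \<in> M" "v \<in> M" "t \<in> {0..1}"
  shows "(d (geod_comb t x y) (geod_comb t u v))\<^sup>2
    \<le> (1 - t) * (d x u)\<^sup>2 + t * (d y v)\<^sup>2 - t * (1 - t) * (d x y - d u v)\<^sup>2"
proof -
  have "(d x v)\<^sup>2 + (d y u)\<^sup>2 \<le> (d x u)\<^sup>2 + (d y v)\<^sup>2 + 2 * d x y * d u v"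
    using quadrilateral_Cauchy_Schwarz[OF assms(1,3,2,4)] by (simp add: commute)
  then have "t * (1 - t) * ((d x v)\<^sup>2 + (d y u)\<^sup>2)
      \<le> t * (1 - t) * ((d x u)\<^sup>2 + (d y v)\<^sup>2 + 2 * d x y * d u v)"
    using assms(5) by (intro mult_left_mono) auto
  then show ?thesis
    using dist_geod_comb_geod_comb_le[OF assms assms(5)]
    by (simp add: algebra_simps power2_eq_square)
qed

section \<open>Defect estimates for property \<open>(P\<^sub>2)\<close>\<close>

text \<open>
  The Cauchy--Schwarz inequality for the sides \<open>d x (S x)\<close> and \<open>d p (S p)\<close> bounds the diagonals
  on the right-hand side of \<open>(P\<^sub>2)\<close>, and a square is left over. In particular \<open>S\<close> is nonexpansive.
\<close>

lemma property_P2_defect: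
  assumes "property_P2 S" "S \<in> M \<rightarrow> M" "x \<in> M" "p \<in> M"
  shows "(d (S x) (S p))\<^sup>2 + (d x (S x) - d p (S p))\<^sup>2 \<le> (d x p)\<^sup>2"
proof -
  have S: "S x \<in> M" "S p \<in> M"
    using assms by auto
  have "2 * (d (S x) (S p))\<^sup>2
      \<le> (d x (S p))\<^sup>2 + (d p (S x))\<^sup>2 - (d x (S x))\<^sup>2 - (d p (S p))\<^sup>2"
    using assms unfolding property_P2_def by blast
  moreover have "(d x (S p))\<^sup>2 + (d p (S x))\<^sup>2
      \<le> (d x p)\<^sup>2 + (d (S x) (S p))\<^sup>2 + 2 * d x (S x) * d p (S p)"
    by (rule quadrilateral_Cauchy_Schwarz[OF assms(3,4) S(1,2)])
  ultimately show ?thesis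
    by (simp add: power2_diff)
qed

text \<open>
  The \<open>l\<close>-weighted sum of the defect estimates for \<open>T1\<close> and \<open>T2\<close>, chained with the convexity
  defect of the geodesics from \<open>T1 x\<close> to \<open>T2 x\<close> and from \<open>T1 p\<close> to \<open>T2 p\<close>. For a fixed point \<open>p\<close>
  of the convex combination the right-hand side telescopes along an orbit.
\<close>

lemma triangle_defect_le:
  assumes P2: "property_P2 T1" "T1 \<in> M \<rightarrow> M" "property_P2 T2" "T2 \<in> M \<rightarrow> M"
    and l: "l \<in> {0..1}" and x: "x \<in> M" and p: "p \<in> M"
  shows "(1 - l) * (d x (T1 x) - d p (T1 p))\<^sup>2 + l * (d x (T2 x) - d p (T2 p))\<^sup>2
      + l * (1 - l) * (d (T1 x) (T2 x) - d (T1 p) (T2 p))\<^sup>2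
    \<le> (d x p)\<^sup>2 - (d (geod_comb l (T1 x) (T2 x)) (geod_comb l (T1 p) (T2 p)))\<^sup>2"
proof -
  have T: "T1 x \<in> M" "T2 x \<in> M" "T1 p \<in> M" "T2 p \<in> M"
    using P2 x p by auto
  have "(1 - l) * ((d (T1 x) (T1 p))\<^sup>2 + (d x (T1 x) - d p (T1 p))\<^sup>2) \<le> (1 - l) * (d x p)\<^sup>2"
    using property_P2_defect[OF P2(1,2) x p] l by (intro mult_left_mono) auto
  moreover have "l * ((d (T2 x) (T2 p))\<^sup>2 + (d x (T2 x) - d p (T2 p))\<^sup>2) \<le> l * (d x p)\<^sup>2"
    using property_P2_defect[OF P2(3,4) x p] l by (intro mult_left_mono) auto
  ultimately show ?thesis
    using geod_comb_convex_defect[OF T l] by (simp add: algebra_simps)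
qed

end

section \<open>Asymptotic regularity\<close>

lemma tendsto_of_weighted_square_le:
  fixes f e :: "nat \<Rightarrow> real"
  assumes "c > 0" "\<And>n. c * (f n - a)\<^sup>2 \<le> e n" "e \<longlonglongrightarrow> 0"
  shows "f \<longlonglongrightarrow> a"
proof -
  have "norm ((f n - a)\<^sup>2) \<le> e n / c" for n
    using assms(1,2) by (simp add: pos_le_divide_eq mult.commute)
  moreover have "(\<lambda>n. e n / c) \<longlonglongrightarrow> 0"
    using tendsto_divide[OF assms(3) tendsto_const[of c]] assms(1) by simp
  ultimately have "(\<lambda>n. (f n - a)\<^sup>2) \<longlonglongrightarrow> 0"
    by (rule Lim_null_comparison[OF always_eventually[OF allI]])
  then have "(\<lambda>n. f n - a) \<longlonglongrightarrow> 0"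
    by simp
  then show ?thesis
    by (rule LIM_zero_cancel)
qed

theorem theorem3p1:
  fixes X :: "'a set" and d :: "'a \<Rightarrow> 'a \<Rightarrow> real"
    and T1 T2 T :: "'a \<Rightarrow> 'a" and l :: real
  assumes "CAT0_space X d"
    and "T1 \<in> X \<rightarrow> X" and "Metric_space.property_P2 X d T1"
    and "T2 \<in> X \<rightarrow> X" and "Metric_space.property_P2 X d T2"
    and "0 < l" and "l < 1"
    and "\<And>x. x \<in> X \<Longrightarrow> T x = CAT0_space.geod_comb X d l (T1 x) (T2 x)"
    and "Metric_space.Fix X T \<noteq> {}"
  shows "Metric_space.asymptotically_regular X d T"
proof -
  interpret CAT0_space X d by fact
  have l: "l \<in> {0..1}"
    using assms(6,7) by simp
  obtain p where p: "p \<in> X" and Tp: "T p = p"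
    using assms(9) unfolding Fix_def by auto
  have TX: "T y \<in> X" if "y \<in> X" for y
    unfolding assms(8)[OF that]
    by (intro geod_comb_in l funcset_mem[OF assms(2)] funcset_mem[OF assms(4)] that)
  define D where "D = d (T1 p) (T2 p)"
  have p_comb: "p = geod_comb l (T1 p) (T2 p)"
    using assms(8)[OF p] Tp by simp
  have T1p: "T1 p \<in> X" and T2p: "T2 p \<in> X"
    using assms(2,4) p by auto
  have p1: "d p (T1 p) = l * D" and p2: "d p (T2 p) = (1 - l) * D"
    using dist_geod_comb_left[OF T1p T2p l] dist_geod_comb_right[OF T1p T2p l]
    unfolding D_def p_comb[symmetric] by simp_all
  show ?thesis
    unfolding asymptotically_regular_def
  proof
    fix x assume x: "x \<in> X"
    define z where "z n = (T ^^ n) x" for n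
    have z: "z n \<in> X" for n
      unfolding z_def by (induction n) (use x TX in auto)
    have z_Suc: "z (Suc n) = geod_comb l (T1 (z n)) (T2 (z n))" for n
      using assms(8)[OF z] by (simp add: z_def)
    define e where "e n = (d (z n) p)\<^sup>2 - (d (z (Suc n)) p)\<^sup>2" for n
    have defect: "(1 - l) * (d (z n) (T1 (z n)) - l * D)\<^sup>2
        + l * (d (z n) (T2 (z n)) - (1 - l) * D)\<^sup>2
        + l * (1 - l) * (d (T1 (z n)) (T2 (z n)) - D)\<^sup>2 \<le> e n" for n
      using triangle_defect_le[OF assms(3,2,5,4) l z[of n] p]
      unfolding e_def z_Suc p_comb[symmetric] p1 p2 D_def .
    have nonneg_terms: "0 \<le> (1 - l) * a\<^sup>2" "0 \<le> l * a\<^sup>2" "0 \<le> l * (1 - l) * a\<^sup>2" for a :: real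
      using assms(6,7) by simp_all
    have "0 \<le> e n" for n
      using defect[of n] by (smt (verit) nonneg_terms)
    then have "decseq (\<lambda>n. (d (z n) p)\<^sup>2)"
      unfolding e_def by (intro decseq_SucI) simp
    then obtain L where L: "(\<lambda>n. (d (z n) p)\<^sup>2) \<longlonglongrightarrow> L"
      by (rule decseq_convergent[where B = 0]) (simp, blast)
    have e: "e \<longlonglongrightarrow> 0"
      unfolding e_def using tendsto_diff[OF L LIMSEQ_Suc[OF L]] by simp
    have lim1: "(\<lambda>n. d (z n) (T1 (z n))) \<longlonglongrightarrow> l * D"
    proof (rule tendsto_of_weighted_square_le[OF _ _ e])
      show "(1 - l) * (d (z n) (T1 (z n)) - l * D)\<^sup>2 \<le> e n" for n
        using defect[of n] by (smt (verit) nonneg_terms)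
    qed (use assms(7) in simp)
    have lim2: "(\<lambda>n. d (z n) (T2 (z n))) \<longlonglongrightarrow> (1 - l) * D"
    proof (rule tendsto_of_weighted_square_le[OF _ _ e])
      show "l * (d (z n) (T2 (z n)) - (1 - l) * D)\<^sup>2 \<le> e n" for n
        using defect[of n] by (smt (verit) nonneg_terms)
    qed (use assms(6) in simp)
    have lim12: "(\<lambda>n. d (T1 (z n)) (T2 (z n))) \<longlonglongrightarrow> D"
    proof (rule tendsto_of_weighted_square_le[OF _ _ e])
      show "l * (1 - l) * (d (T1 (z n)) (T2 (z n)) - D)\<^sup>2 \<le> e n" for n
        using defect[of n] by (smt (verit) nonneg_terms)
    qed (use assms(6,7) in simp)
    define b where "b n = (1 - l) * (d (z n) (T1 (z n)))\<^sup>2 + l * (d (z n) (T2 (z n)))\<^sup>2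
        - l * (1 - l) * (d (T1 (z n)) (T2 (z n)))\<^sup>2" for n
    have "b \<longlonglongrightarrow> (1 - l) * (l * D)\<^sup>2 + l * ((1 - l) * D)\<^sup>2 - l * (1 - l) * D\<^sup>2"
      unfolding b_def by (intro tendsto_intros lim1 lim2 lim12)
    \<comment> \<open>the limit is the CAT(0) bound for \<open>p\<close>, which lies on the geodesic itself\<close>
    moreover have "(1 - l) * (l * D)\<^sup>2 + l * ((1 - l) * D)\<^sup>2 - l * (1 - l) * D\<^sup>2 = 0"
      by (simp add: algebra_simps power2_eq_square)
    ultimately have b: "b \<longlonglongrightarrow> 0"
      by simp
    have bound: "(d (z n) (z (Suc n)))\<^sup>2 \<le> b n" for n
      unfolding z_Suc b_def using assms(2,4) z[of n] by (intro CAT0_geod_comb l) auto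
    have "(\<lambda>n. d (z n) (z (Suc n))) \<longlonglongrightarrow> 0"
      using tendsto_of_weighted_square_le[of 1 "\<lambda>n. d (z n) (z (Suc n))" 0 b] bound b by simp
    then show "(\<lambda>n. d ((T ^^ n) x) ((T ^^ (n + 1)) x)) \<longlonglongrightarrow> 0"
      by (simp add: z_def)
  qed
qed

end
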